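(* Let $\Omega\subset\mathbb{R}^2$ be open and let $F\in C^2(\Omega)$. Fix $(t,x),(s,y)\in\Omega$. Define $$a:=\mathcal{L}_F^2F(t,x),\quad b:=3F(t,x)\bigl(\mathcal{L}_FF(t,x)\bigr)^2,\quad c:=F(t,x)^2,$$ $$d:=\mathcal{L}_F^2F(s,y),\quad e:=3F(s,y)\bigl(\mathcal{L}_FF(s,y)\bigr)^2,\quad f:=F(s,y)^2,$$ $$A:=a+d,\quad B:=(a+d)(c+f)-b-e,\quad C:=(a+d)cf-bf-ec,\quad D:=B^2-4AC.$$ Consider the problem $$\inf_{\sigma>0}\left|\mathcal{D}_\sigma(t,x)+\mathcal{D}_\sigma(s,y)\right|.\qquad(\ast)$$ The boundary residuals are $R_0:=\lim_{\sigma\searrow0}|\mathcal{D}_\sigma(t,x)+\mathcal{D}_\sigma(s,y)|$ and $R_\infty:=\lim_{\sigma\to\infty}|\mathcal{D}_\sigma(t,x)+\mathcal{D}_\sigma(s,y)|=|A|$. Exactly one of the following six cases (E1)–(E6) occurs. (E1) Suppose that $A=B=C=0$. Then every $\sigma>0$ is an optimal minimizer of $(\ast)$. (E2) Suppose that $A=0$ and $BC<0$. Then $(\ast)$ has the unique optimal minimizer $\sigma^\ast=\left(-\frac{bf+ec}{b+e}\right)^{1/2}$. (E3) Suppose that $A=0$, $BC\ge0$, and $(B,C)\ne(0,0)$. Then $(\ast)$ has no positive minimizer. More precisely, exactly one of the following cases occurs. (E3a) If $cf>0$ and $C=0$, then $\inf_{\sigma>0}|\mathcal{D}_\sigma(t,x)+\mathcal{D}_\sigma(s,y)|=R_\infty=R_0=0$.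 (E3b) Suppose that one of the following conditions holds: (E3b1) $cf>0$ and $C\ne0$; (E3b2) $cf=0$. Then $\inf_{\sigma>0}|\mathcal{D}_\sigma(t,x)+\mathcal{D}_\sigma(s,y)|=R_\infty=0<R_0$. (E4) Suppose that $A\ne0$, $D>0$, $AB<0$, and $AC>0$. Then $(\ast)$ has exactly two optimal minimizers, $\sigma_\pm^\ast=\left(\frac{-B\pm\sqrt{D}}{2A}\right)^{1/2}$. (E5) Suppose that $A\ne0$ and one of the following conditions holds: (E5a) $D>0$, $AB<0$, and $AC=0$; (E5b) $D>0$ and $AC<0$; (E5c) $D=0$, $AB<0$. Then $(\ast)$ has the unique optimal minimizer $\sigma^\ast=\left(\frac{-B+\operatorname{sgn}(A)\sqrt{D}}{2A}\right)^{1/2}$. (E6) Suppose that $A\ne0$ and one of the following conditions holds: (i) $D>0$, $AB>0$, and $AC\ge0$; (ii) $D=0$ and $AB\ge0$; (iii) $D<0$. Then no positive scale makes the defect residual $\mathcal{D}_\sigma(t,x)+\mathcal{D}_\sigma(s,y)$ vanish. Consequently, $(\ast)$ has no optimal minimizer. More precisely, exactly one of the following cases occurs. (E6a) If $B=A(c+f)$ and $C=Acf$, then every positive scale is a minimizer of $(\ast)$, but none is optimal. (E6b) Suppose that one of the following conditions holds: (i) $cf>0$ and $C=0$; (ii) $cf=0$, $c+f>0$, and $B=0$. Then $(\ast)$ has no positive minimizer, and $\inf_{\sigma>0}|\mathcal{D}_\sigma(t,x)+\mathcal{D}_\sigma(s,y)|=R_0=0$. (E6c) If neither case (E6a) nor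 case (E6b) applies, then $\inf_{\sigma>0}|\mathcal{D}_\sigma(t,x)+\mathcal{D}_\sigma(s,y)|>0$ and $R_0>0$.
   Context: For $G\in C^1(\Omega)$, $\mathcal{L}_FG:=G_t+FG_x$, where $(t,x)$ are the coordinates in $\Omega$; for $G\in C^2(\Omega)$, $\mathcal{L}_F^2G:=\mathcal{L}_F(\mathcal{L}_FG)$. For $\sigma>0$ the curvature-variation defect field is $$\mathcal{D}_\sigma(t,x):=\mathcal{L}_F^2F(t,x)-\frac{3F(t,x)\bigl(\mathcal{L}_FF(t,x)\bigr)^2}{\sigma^2+F(t,x)^2}.$$ A minimizer of $(\ast)$ is a $\sigma>0$ at which the infimum is attained; a minimizer $\sigma>0$ is called optimal if $\mathcal{D}_\sigma(t,x)+\mathcal{D}_\sigma(s,y)=0$. $\operatorname{sgn}$ is the sign function. *)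

theory Defs
  imports "HOL-Analysis.Analysis"
begin

text \<open>Points of the plane are pairs \<open>(t, x)\<close>. The partial derivatives are total functions; at a
  point of an open set they depend only on the values of the function on that set, so values
  outside the domain of interest play no role.\<close>

definition partial_t :: "(real \<times> real \<Rightarrow> real) \<Rightarrow> real \<times> real \<Rightarrow> real" where
  "partial_t G = (\<lambda>(t, x). deriv (\<lambda>u. G (u, x)) t)"

definition partial_x :: "(real \<times> real \<Rightarrow> real) \<Rightarrow> real \<times> real \<Rightarrow> real" where
  "partial_x G = (\<lambda>(t, x). deriv (\<lambda>u. G (t, u)) x)"

text \<open>\<open>Ck_on k \<Omega> G\<close> expresses \<open>G \<in> C\<^sup>k(\<Omega>)\<close>; it is meant for open \<open>\<Omega>\<close>.\<close>

primrec Ck_on :: "nat \<Rightarrow> (real \<times> real) set \<Rightarrow> (real \<times> real \<Rightarrow> real) \<Rightarrow> bool" where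
  "Ck_on 0 \<Omega> G \<longleftrightarrow> continuous_on \<Omega> G"
| "Ck_on (Suc k) \<Omega> G \<longleftrightarrow>
     continuous_on \<Omega> G \<and>
     (\<forall>(t, x) \<in> \<Omega>. (\<lambda>u. G (u, x)) differentiable (at t) \<and> (\<lambda>u. G (t, u)) differentiable (at x)) \<and>
     Ck_on k \<Omega> (partial_t G) \<and> Ck_on k \<Omega> (partial_x G)"

definition Lie :: "(real \<times> real \<Rightarrow> real) \<Rightarrow> (real \<times> real \<Rightarrow> real) \<Rightarrow> real \<times> real \<Rightarrow> real" where
  "Lie F G = (\<lambda>p. partial_t G p + F p * partial_x G p)"

definition defect :: "(real \<times> real \<Rightarrow> real) \<Rightarrow> real \<Rightarrow> real \<times> real \<Rightarrow> real" where
  "defect F \<sigma> p = Lie F (Lie F F) p - 3 * F p * (Lie F F p)\<^sup>2 / (\<sigma>\<^sup>2 + (F p)\<^sup>2)"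

definition defect_residual ::
    "(real \<times> real \<Rightarrow> real) \<Rightarrow> real \<times> real \<Rightarrow> real \<times> real \<Rightarrow> real \<Rightarrow> real" where
  "defect_residual F p q \<sigma> = defect F \<sigma> p + defect F \<sigma> q"

definition residual_inf :: "(real \<times> real \<Rightarrow> real) \<Rightarrow> real \<times> real \<Rightarrow> real \<times> real \<Rightarrow> real" where
  "residual_inf F p q = (INF \<sigma>\<in>{0<..}. \<bar>defect_residual F p q \<sigma>\<bar>)"

definition minimizer :: "(real \<times> real \<Rightarrow> real) \<Rightarrow> real \<times> real \<Rightarrow> real \<times> real \<Rightarrow> real \<Rightarrow> bool" where
  "minimizer F p q \<sigma> \<longleftrightarrow> \<sigma> > 0 \<and> \<bar>defect_residual F p q \<sigma>\<bar> = residual_inf F p q"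

definition optimal_minimizer ::
    "(real \<times> real \<Rightarrow> real) \<Rightarrow> real \<times> real \<Rightarrow> real \<times> real \<Rightarrow> real \<Rightarrow> bool" where
  "optimal_minimizer F p q \<sigma> \<longleftrightarrow> minimizer F p q \<sigma> \<and> defect_residual F p q \<sigma> = 0"

text \<open>Positions are counted, so repeated equal truth values in the list are told apart.\<close>

definition exactly_one :: "bool list \<Rightarrow> bool" where
  "exactly_one Ps \<longleftrightarrow> (\<exists>!i. i < length Ps \<and> Ps ! i)"

end

theory Submission
  imports Defs "HOL-Library.Quadratic_Discriminant"
begin

text \<open>With \<open>z = \<sigma>\<^sup>2\<close> the defect residual is \<open>r = A - b / (z + c) - e / (z + f)\<close>, and
  \<open>(z + c) (z + f) r = A z\<^sup>2 + B z + C\<close>. So the optimal minimizers are the square roots of the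
  positive zeros of a quadratic, and the signs of \<open>A B\<close>, \<open>A C\<close> and \<open>D\<close> count these by Vieta.
  When there is no positive zero, \<open>\<bar>r\<bar>\<close> is a positive continuous function on \<open>(0, \<infinity>)\<close>, and its
  infimum is positive exactly when both boundary limits are.\<close>

section \<open>Counting true positions in a list\<close>

text \<open>Positions in the tail are shifted by one, so equal truth values stay distinct. Rewriting
  with this equation turns a literal list into a propositional formula.\<close>

lemma exactly_one_Cons:
  "exactly_one (P # Ps) \<longleftrightarrow> (if P then list_all Not Ps else exactly_one Ps)"
proof (cases P)
  case True
  have "exactly_one (P # Ps) \<longleftrightarrow> (\<forall>i < length Ps. \<not> Ps ! i)"
  proof
    assume "exactly_one (P # Ps)"
    then show "\<forall>i < length Ps. \<not> Ps ! i"
      using True unfolding exactly_one_def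
      by (metis Suc_less_eq length_Cons nat.distinct(1) nth_Cons_0 nth_Cons_Suc zero_less_Suc)
  next
    assume "\<forall>i < length Ps. \<not> Ps ! i"
    then show "exactly_one (P # Ps)"
      using True unfolding exactly_one_def
      by (intro ex1I[of _ 0]) (auto simp: nth_Cons split: nat.splits)
  qed
  with True show ?thesis
    by (simp add: list_all_length)
next
  case False
  have *: "i < length (P # Ps) \<and> (P # Ps) ! i \<longleftrightarrow> (\<exists>j. i = Suc j \<and> j < length Ps \<and> Ps ! j)" for i
    using False by (cases i) auto
  show ?thesis
    using False unfolding exactly_one_def * by (simp only: if_False) blast
qed

lemma exactly_one_Nil [simp]: "\<not> exactly_one []"
  by (auto simp: exactly_one_def)

section \<open>Infima and minimizers\<close>

text \<open>The infimum lies below every value at a positive scale, hence below their limit. This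
  serves infima that are only approached, at \<open>0\<close> or at infinity, and need not be
  attained.\<close>

lemma residual_inf_eqI:
  fixes p q :: "real \<times> real"
  assumes "\<And>\<sigma>. \<sigma> > 0 \<Longrightarrow> L \<le> \<bar>defect_residual F p q \<sigma>\<bar>"
    and "((\<lambda>\<sigma>. \<bar>defect_residual F p q \<sigma>\<bar>) \<longlongrightarrow> L) G" "G \<noteq> bot" "\<forall>\<^sub>F \<sigma> in G. \<sigma> > 0"
  shows "residual_inf F p q = L"
proof -
  have bdd: "bdd_below ((\<lambda>\<sigma>. \<bar>defect_residual F p q \<sigma>\<bar>) ` {0<..})"
    by (rule bdd_belowI[of _ 0]) auto
  have "\<forall>\<^sub>F \<sigma> in G. residual_inf F p q \<le> \<bar>defect_residual F p q \<sigma>\<bar>"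
    using assms(4)
    by eventually_elim (auto simp: residual_inf_def intro!: cINF_lower[OF bdd])
  then have "residual_inf F p q \<le> L"
    using assms(2,3) by (intro tendsto_lowerbound)
  moreover have "L \<le> residual_inf F p q"
    unfolding residual_inf_def using assms(1) by (intro cINF_greatest) auto
  ultimately show ?thesis by simp
qed

lemma residual_inf_nonneg: "residual_inf F p q \<ge> 0"
  unfolding residual_inf_def by (intro cINF_greatest) auto

lemma residual_inf_le: "\<sigma> > 0 \<Longrightarrow> residual_inf F p q \<le> \<bar>defect_residual F p q \<sigma>\<bar>"
  unfolding residual_inf_def by (intro cINF_lower bdd_belowI[of _ 0]) auto

text \<open>A zero of the residual is automatically a minimizer, since the infimum of absolute
  values cannot be negative.\<close>

lemma optimal_minimizer_iff:
  "optimal_minimizer F p q \<sigma> \<longleftrightarrow> \<sigma> > 0 \<and> defect_residual F p q \<sigma> = 0"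
  using residual_inf_le[of \<sigma> F p q] residual_inf_nonneg[of F p q]
  by (auto simp: optimal_minimizer_def minimizer_def)

lemma minimizer_if_const:
  assumes "\<And>\<sigma>. \<sigma> > 0 \<Longrightarrow> \<bar>defect_residual F p q \<sigma>\<bar> = k" and "\<sigma> > 0"
  shows "minimizer F p q \<sigma>"
proof -
  have "residual_inf F p q = k"
    unfolding residual_inf_def using assms(1) by (subst INF_cong[OF refl, where D = "\<lambda>_. k"]) auto
  then show ?thesis
    using assms by (simp add: minimizer_def)
qed

text \<open>Near each end \<open>h\<close> exceeds half of its limit there; on the compact interval
  in between it attains a positive minimum. The least of these three numbers is a positive lower
  bound.\<close>

lemma INF_pos_if_limits_pos:
  fixes h :: "real \<Rightarrow> real"
  assumes cont: "continuous_on {0<..} h" and pos: "\<And>x. x > 0 \<Longrightarrow> h x > 0"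
    and lim0: "(h \<longlongrightarrow> l) (at_right 0)" and "l > 0"
    and liminf: "(h \<longlongrightarrow> m) at_top" and "m > 0"
  shows "(INF x\<in>{0<..}. h x) > 0"
proof -
  have "\<forall>\<^sub>F x in at_right 0. h x > l / 2"
    using lim0 \<open>l > 0\<close> by (intro order_tendstoD) auto
  then obtain \<delta> where \<delta>: "\<delta> > 0" "\<And>x. 0 < x \<Longrightarrow> x < \<delta> \<Longrightarrow> h x > l / 2"
    by (auto simp: eventually_at_right_field)
  have "\<forall>\<^sub>F x in at_top. h x > m / 2"
    using liminf \<open>m > 0\<close> by (intro order_tendstoD) auto
  then obtain M where M: "\<And>x. x \<ge> M \<Longrightarrow> h x > m / 2"
    by (auto simp: eventually_at_top_linorder)
  \<comment> \<open>The maximum with \<delta> keeps the interval nonempty when \<open>M\<close> is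
    smaller than \<delta>.\<close>
  have "continuous_on {\<delta>..max \<delta> M} h"
    using \<delta>(1) by (intro continuous_on_subset[OF cont]) auto
  then obtain x0 where x0: "x0 \<in> {\<delta>..max \<delta> M}" "\<And>x. x \<in> {\<delta>..max \<delta> M} \<Longrightarrow> h x0 \<le> h x"
    using continuous_attains_inf[of "{\<delta>..max \<delta> M}" h] by auto
  define k where "k = min (h x0) (min (l / 2) (m / 2))"
  have "h x0 > 0" using pos x0(1) \<delta>(1) by auto
  then have "k > 0" using assms by (simp add: k_def)
  moreover have "k \<le> h x" if "x > 0" for x
  proof -
    consider "x < \<delta>" | "x \<in> {\<delta>..max \<delta> M}" | "x \<ge> M" by force
    then show ?thesis
      using \<delta>(2)[OF that] M[of x] x0(2)[of x] unfolding k_def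
      by cases (simp_all add: min_le_iff_disj)
  qed
  then have "k \<le> (INF x\<in>{0<..}. h x)"
    by (intro cINF_greatest) auto
  ultimately show ?thesis by simp
qed

section \<open>Roots of a real quadratic\<close>

text \<open>The factor \<open>sgn A\<close> makes \<open>z1\<close> the larger root whatever the
  sign of \<open>A\<close>: the difference of the roots is the square root of the discriminant
  divided by \<bar>A\<bar>. Vieta's relations are multiplied through to carry the positive factor
  \<open>A\<^sup>2\<close>, so that the signs of \<open>A * B\<close> and \<open>A * C\<close> can
  be read off directly.\<close>

lemma quadratic_factors:
  fixes A B C :: real
  assumes "A \<noteq> 0" and "B\<^sup>2 - 4 * A * C \<ge> 0"
  obtains z1 z2 where "z1 = (- B + sgn A * sqrt (B\<^sup>2 - 4 * A * C)) / (2 * A)"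
    and "z2 = (- B - sgn A * sqrt (B\<^sup>2 - 4 * A * C)) / (2 * A)"
    and "z1 \<ge> z2" "z1 = z2 \<longleftrightarrow> B\<^sup>2 - 4 * A * C = 0"
    and "A * B = - A\<^sup>2 * (z1 + z2)" "A * C = A\<^sup>2 * (z1 * z2)"
    and "\<And>z. A * z\<^sup>2 + B * z + C = 0 \<longleftrightarrow> z = z1 \<or> z = z2"
proof -
  define w where "w = sqrt (B\<^sup>2 - 4 * A * C)"
  have w: "w \<ge> 0" "w\<^sup>2 = B\<^sup>2 - 4 * A * C"
    using assms(2) by (simp_all add: w_def)
  define z1 where "z1 = (- B + sgn A * w) / (2 * A)"
  define z2 where "z2 = (- B - sgn A * w) / (2 * A)"
  have sgn2: "(sgn A)\<^sup>2 = 1"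
    using assms(1) by (simp add: sgn_if)
  have diff: "z1 - z2 = w / \<bar>A\<bar>"
    using assms(1) by (auto simp: z1_def z2_def sgn_if field_simps)
  have sum: "A * (z1 + z2) = - B"
    using assms(1) by (simp add: z1_def z2_def field_simps)
  have "4 * A\<^sup>2 * (z1 * z2) = (- B + sgn A * w) * (- B - sgn A * w)"
    using assms(1) by (simp add: z1_def z2_def power2_eq_square)
  also have "\<dots> = B\<^sup>2 - (sgn A)\<^sup>2 * w\<^sup>2"
    by (simp add: power2_eq_square algebra_simps)
  finally have prod: "A * (z1 * z2) = C"
    using assms(1) w(2) sgn2 by (simp add: power2_eq_square)
  have "A * z\<^sup>2 + B * z + C = A * ((z - z1) * (z - z2))" for z
    using sum prod by algebra
  then have roots: "A * z\<^sup>2 + B * z + C = 0 \<longleftrightarrow> z = z1 \<or> z = z2" for z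
    using assms(1) by simp
  show thesis
  proof (rule that)
    have "z1 - z2 \<ge> 0" using diff w(1) by simp
    then show "z1 \<ge> z2" by simp
    have "z1 = z2 \<longleftrightarrow> w = 0" using diff assms(1) by auto
    then show "z1 = z2 \<longleftrightarrow> B\<^sup>2 - 4 * A * C = 0" by (simp add: w_def)
    show "A * B = - A\<^sup>2 * (z1 + z2)"
      using sum by algebra
    show "A * C = A\<^sup>2 * (z1 * z2)"
      by (simp add: power2_eq_square flip: prod)
  qed (simp_all add: roots z1_def z2_def w_def)
qed

section \<open>Boundary limits of a single pole term\<close>

text \<open>If \<open>c = 0\<close> then \<open>b / c = 0\<close> in HOL, which together with \<open>b = 0\<close> makes
  \<open>b / (\<sigma>\<^sup>2 + c)\<close> continuous at \<open>0\<close> in every case.\<close>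

lemma pole_term_tendsto:
  fixes b c :: real
  assumes "c = 0 \<Longrightarrow> b = 0"
  shows "((\<lambda>\<sigma>. b / (\<sigma>\<^sup>2 + c)) \<longlongrightarrow> b / c) (at_right 0)"
proof (cases "c = 0")
  case False
  have "((\<lambda>\<sigma>. b / (\<sigma>\<^sup>2 + c)) \<longlongrightarrow> b / (0\<^sup>2 + c)) (at_right 0)"
    using False by (intro tendsto_intros) auto
  then show ?thesis by simp
qed (use assms in simp)

lemma pole_term_tendsto_at_top:
  fixes b c :: real
  shows "((\<lambda>\<sigma>. b / (\<sigma>\<^sup>2 + c)) \<longlongrightarrow> 0) at_top"
proof (intro tendsto_divide_0[OF tendsto_const] filterlim_at_top_imp_at_infinity)
  have "filterlim (\<lambda>\<sigma>::real. \<sigma>\<^sup>2) at_top at_top"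
    by (intro filterlim_pow_at_top filterlim_ident) simp
  then show "filterlim (\<lambda>\<sigma>. \<sigma>\<^sup>2 + c) at_top at_top"
    by (subst add.commute) (intro filterlim_tendsto_add_at_top[OF tendsto_const])
qed

section \<open>The residual as a rational function of the squared scale\<close>

text \<open>This isolates what the case analysis needs from \<open>F\<close>. The formula for
  \<open>r\<close> also covers scale \<open>0\<close>, where the convention for division by zero
  makes \<open>r 0\<close> the limit from the right; the boundary residual is then simply \<bar>r
  0\<bar>.\<close>

locale two_pole_function =
  fixes A b c e f B C :: real and r :: "real \<Rightarrow> real"
  assumes c: "c \<ge> 0" "c = 0 \<Longrightarrow> b = 0" and f: "f \<ge> 0" "f = 0 \<Longrightarrow> e = 0"
    and r: "r \<sigma> = A - b / (\<sigma>\<^sup>2 + c) - e / (\<sigma>\<^sup>2 + f)"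
    and B: "B = A * (c + f) - b - e"
    and C: "C = A * c * f - b * f - e * c"
begin

lemma times_denominators:
  assumes "\<sigma> > 0"
  shows "r \<sigma> * ((\<sigma>\<^sup>2 + c) * (\<sigma>\<^sup>2 + f)) = A * (\<sigma>\<^sup>2)\<^sup>2 + B * \<sigma>\<^sup>2 + C"
proof -
  have "\<sigma>\<^sup>2 + c > 0" "\<sigma>\<^sup>2 + f > 0"
    using assms c(1) f(1) by (simp_all add: add_pos_nonneg)
  then have "r \<sigma> * ((\<sigma>\<^sup>2 + c) * (\<sigma>\<^sup>2 + f))
      = A * ((\<sigma>\<^sup>2 + c) * (\<sigma>\<^sup>2 + f)) - b * (\<sigma>\<^sup>2 + f) - e * (\<sigma>\<^sup>2 + c)"
    by (simp add: r left_diff_distrib)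
  then show ?thesis
    by (simp add: B C power2_eq_square algebra_simps)
qed

lemma zero_iff:
  assumes "\<sigma> > 0"
  shows "r \<sigma> = 0 \<longleftrightarrow> A * (\<sigma>\<^sup>2)\<^sup>2 + B * \<sigma>\<^sup>2 + C = 0"
proof -
  have "\<sigma>\<^sup>2 + c > 0" "\<sigma>\<^sup>2 + f > 0"
    using assms c(1) f(1) by (simp_all add: add_pos_nonneg)
  then show ?thesis
    unfolding times_denominators[OF assms, symmetric] by simp
qed

lemma abs_tendsto_0: "((\<lambda>\<sigma>. \<bar>r \<sigma>\<bar>) \<longlongrightarrow> \<bar>r 0\<bar>) (at_right 0)"
  unfolding r using c(2) f(2) by (auto intro!: tendsto_intros pole_term_tendsto)

lemma abs_tendsto_at_top: "((\<lambda>\<sigma>. \<bar>r \<sigma>\<bar>) \<longlongrightarrow> \<bar>A\<bar>) at_top"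
proof -
  have "((\<lambda>\<sigma>. \<bar>r \<sigma>\<bar>) \<longlongrightarrow> \<bar>A - 0 - 0\<bar>) at_top"
    unfolding r by (intro tendsto_intros pole_term_tendsto_at_top)
  then show ?thesis by simp
qed

lemma continuous_on_pos: "continuous_on {0<..} r"
  unfolding r using c(1) f(1)
  by (auto intro!: continuous_intros simp: add_nonneg_eq_0_iff)

lemma at_0_if_poles: "c * f > 0 \<Longrightarrow> r 0 = C / (c * f)"
  by (simp add: r C zero_less_mult_iff) (auto simp: field_simps)

text \<open>Exactly one of \<open>c\<close> and \<open>f\<close> is zero, and its numerator vanishes
  with it. Hence \<open>C = 0\<close>, a factor \<open>z\<close> cancels, and the quotient reduces
  to \<open>(A * z + B) / (z + c + f)\<close>.\<close>

lemma at_0_if_one_pole: "c * f = 0 \<Longrightarrow> c + f > 0 \<Longrightarrow> r 0 = B / (c + f)"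
  using c f by (auto simp: r B field_simps)

lemma no_pole: "c + f = 0 \<Longrightarrow> b = 0 \<and> c = 0 \<and> e = 0 \<and> f = 0"
  using c f by (simp add: add_nonneg_eq_0_iff)

text \<open>This decides when the boundary residual at \<open>0\<close> vanishes. The three
  alternatives correspond to two, one or no nonzero values among \<open>c\<close> and
  \<open>f\<close>; the first two together are the condition \<open>E6b\<close>.\<close>

lemma at_0_eq_0_iff:
  "r 0 = 0 \<longleftrightarrow> (c * f > 0 \<and> C = 0) \<or> (c * f = 0 \<and> c + f > 0 \<and> B = 0) \<or> (c + f = 0 \<and> A = 0)"
proof -
  have "c * f \<ge> 0" "c + f \<ge> 0" using c f by auto
  then consider "c * f > 0" | "c * f = 0" "c + f > 0" | "c + f = 0" by linarith
  then show ?thesis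
  proof cases
    case 1
    then have "c + f \<noteq> 0" using no_pole by auto
    with 1 show ?thesis using at_0_if_poles by auto
  next
    case 2
    then show ?thesis using at_0_if_one_pole by auto
  next
    case 3
    then show ?thesis using no_pole[OF 3] by (simp add: r)
  qed
qed

text \<open>The two equations say \<open>b + e = 0\<close> and \<open>b * f + e * c = 0\<close>, so
  the combined pole terms cancel and the numerator is \<open>A\<close> times the
  denominator.\<close>

lemma const_if:
  assumes "B = A * (c + f)" and "C = A * c * f" and "\<sigma> > 0"
  shows "r \<sigma> = A"
proof -
  have "\<sigma>\<^sup>2 + c > 0" "\<sigma>\<^sup>2 + f > 0"
    using assms(3) c(1) f(1) by (simp_all add: add_pos_nonneg)
  moreover have "r \<sigma> * ((\<sigma>\<^sup>2 + c) * (\<sigma>\<^sup>2 + f)) = A * ((\<sigma>\<^sup>2 + c) * (\<sigma>\<^sup>2 + f))"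
    unfolding times_denominators[OF assms(3)] assms(1,2)
    by (simp add: power2_eq_square algebra_simps)
  ultimately show ?thesis by simp
qed

lemma abs_bounded_away_from_0:
  assumes "\<And>\<sigma>. \<sigma> > 0 \<Longrightarrow> r \<sigma> \<noteq> 0" and "A \<noteq> 0" and "r 0 \<noteq> 0"
  shows "(INF \<sigma>\<in>{0<..}. \<bar>r \<sigma>\<bar>) > 0"
proof (rule INF_pos_if_limits_pos[OF _ _ abs_tendsto_0 _ abs_tendsto_at_top])
  show "continuous_on {0<..} (\<lambda>\<sigma>. \<bar>r \<sigma>\<bar>)"
    by (intro continuous_on_rabs continuous_on_pos)
qed (use assms in auto)

end

section \<open>Case analysis for the defect residual\<close>

lemma defect_residual_eq:
  "defect_residual F p q \<sigma> = Lie F (Lie F F) p + Lie F (Lie F F) q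
    - 3 * F p * (Lie F F p)\<^sup>2 / (\<sigma>\<^sup>2 + (F p)\<^sup>2) - 3 * F q * (Lie F F q)\<^sup>2 / (\<sigma>\<^sup>2 + (F q)\<^sup>2)"
  by (simp add: defect_residual_def defect_def)

lemma sqrt_eq_iff_pos:
  fixes \<sigma> z :: real
  assumes "z > 0"
  shows "\<sigma> = sqrt z \<longleftrightarrow> \<sigma> > 0 \<and> \<sigma>\<^sup>2 = z"
  using assms by (auto simp: real_sqrt_unique)

theorem theorem6p3:
  fixes \<Omega> :: "(real \<times> real) set" and F :: "real \<times> real \<Rightarrow> real"
    and t x s y a b c d e f A B C D R0 Rinf :: real
    and E1 E2 E3 E3a E3b E4 E5 E6 E6a E6b E6c :: bool
  assumes "open \<Omega>" and "Ck_on 2 \<Omega> F" and "(t, x) \<in> \<Omega>" and "(s, y) \<in> \<Omega>"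
    and "a = Lie F (Lie F F) (t, x)"
    and "b = 3 * F (t, x) * (Lie F F (t, x))\<^sup>2"
    and "c = (F (t, x))\<^sup>2"
    and "d = Lie F (Lie F F) (s, y)"
    and "e = 3 * F (s, y) * (Lie F F (s, y))\<^sup>2"
    and "f = (F (s, y))\<^sup>2"
    and "A = a + d"
    and "B = (a + d) * (c + f) - b - e"
    and "C = (a + d) * c * f - b * f - e * c"
    and "D = B\<^sup>2 - 4 * A * C"
    and "R0 = Lim (at_right 0) (\<lambda>\<sigma>. \<bar>defect_residual F (t, x) (s, y) \<sigma>\<bar>)"
    and "Rinf = Lim at_top (\<lambda>\<sigma>. \<bar>defect_residual F (t, x) (s, y) \<sigma>\<bar>)"
    and "E1 \<longleftrightarrow> A = 0 \<and> B = 0 \<and> C = 0"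
    and "E2 \<longleftrightarrow> A = 0 \<and> B * C < 0"
    and "E3 \<longleftrightarrow> A = 0 \<and> B * C \<ge> 0 \<and> (B, C) \<noteq> (0, 0)"
    and "E3a \<longleftrightarrow> c * f > 0 \<and> C = 0"
    and "E3b \<longleftrightarrow> (c * f > 0 \<and> C \<noteq> 0) \<or> c * f = 0"
    and "E4 \<longleftrightarrow> A \<noteq> 0 \<and> D > 0 \<and> A * B < 0 \<and> A * C > 0"
    and "E5 \<longleftrightarrow> A \<noteq> 0 \<and>
           ((D > 0 \<and> A * B < 0 \<and> A * C = 0) \<or> (D > 0 \<and> A * C < 0) \<or> (D = 0 \<and> A * B < 0))"
    and "E6 \<longleftrightarrow> A \<noteq> 0 \<and>
           ((D > 0 \<and> A * B > 0 \<and> A * C \<ge> 0) \<or> (D = 0 \<and> A * B \<ge> 0) \<or> D < 0)"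
    and "E6a \<longleftrightarrow> B = A * (c + f) \<and> C = A * c * f"
    and "E6b \<longleftrightarrow> (c * f > 0 \<and> C = 0) \<or> (c * f = 0 \<and> c + f > 0 \<and> B = 0)"
    and "E6c \<longleftrightarrow> \<not> E6a \<and> \<not> E6b"
  shows "((\<lambda>\<sigma>. \<bar>defect_residual F (t, x) (s, y) \<sigma>\<bar>) \<longlongrightarrow> R0) (at_right 0) \<and>
    ((\<lambda>\<sigma>. \<bar>defect_residual F (t, x) (s, y) \<sigma>\<bar>) \<longlongrightarrow> Rinf) at_top \<and> Rinf = \<bar>A\<bar> \<and>
    exactly_one [E1, E2, E3, E4, E5, E6] \<and>
    (E1 \<longrightarrow> (\<forall>\<sigma>>0. optimal_minimizer F (t, x) (s, y) \<sigma>)) \<and>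
    (E2 \<longrightarrow> (\<forall>\<sigma>. optimal_minimizer F (t, x) (s, y) \<sigma> \<longleftrightarrow> \<sigma> = sqrt (- ((b * f + e * c) / (b + e))))) \<and>
    (E3 \<longrightarrow>
      (\<nexists>\<sigma>. minimizer F (t, x) (s, y) \<sigma>) \<and>
      exactly_one [E3a, E3b] \<and>
      (E3a \<longrightarrow> residual_inf F (t, x) (s, y) = Rinf \<and> Rinf = R0 \<and> R0 = 0) \<and>
      (E3b \<longrightarrow> residual_inf F (t, x) (s, y) = Rinf \<and> Rinf = 0 \<and> 0 < R0)) \<and>
    (E4 \<longrightarrow>
      sqrt ((- B + sqrt D) / (2 * A)) \<noteq> sqrt ((- B - sqrt D) / (2 * A)) \<and>
      (\<forall>\<sigma>. optimal_minimizer F (t, x) (s, y) \<sigma> \<longleftrightarrow>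
         \<sigma> = sqrt ((- B + sqrt D) / (2 * A)) \<or> \<sigma> = sqrt ((- B - sqrt D) / (2 * A)))) \<and>
    (E5 \<longrightarrow>
      (\<forall>\<sigma>. optimal_minimizer F (t, x) (s, y) \<sigma> \<longleftrightarrow> \<sigma> = sqrt ((- B + sgn A * sqrt D) / (2 * A)))) \<and>
    (E6 \<longrightarrow>
      (\<forall>\<sigma>>0. defect_residual F (t, x) (s, y) \<sigma> \<noteq> 0) \<and>
      (\<nexists>\<sigma>. optimal_minimizer F (t, x) (s, y) \<sigma>) \<and>
      exactly_one [E6a, E6b, E6c] \<and>
      (E6a \<longrightarrow> (\<forall>\<sigma>>0. minimizer F (t, x) (s, y) \<sigma> \<and> \<not> optimal_minimizer F (t, x) (s, y) \<sigma>)) \<and>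
      (E6b \<longrightarrow> (\<nexists>\<sigma>. minimizer F (t, x) (s, y) \<sigma>) \<and>
         residual_inf F (t, x) (s, y) = R0 \<and> R0 = 0) \<and>
      (E6c \<longrightarrow> residual_inf F (t, x) (s, y) > 0 \<and> R0 > 0))"
proof -
  let ?r = "defect_residual F (t, x) (s, y)"
  \<comment> \<open>\<open>c\<close> and \<open>f\<close> are squares of values of \<open>F\<close>,
    and \<open>b\<close> and \<open>e\<close> contain these values as factors, so a vanishing
    \<open>c\<close> or \<open>f\<close> forces a vanishing numerator.\<close>
  interpret two_pole_function A b c e f B C ?r
    by unfold_locales (use assms in \<open>auto simp: defect_residual_eq\<close>)
  have R0: "R0 = \<bar>?r 0\<bar>"
    unfolding \<open>R0 = _\<close> by (intro tendsto_Lim abs_tendsto_0) simp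
  have Rinf: "Rinf = \<bar>A\<bar>"
    unfolding \<open>Rinf = _\<close> by (intro tendsto_Lim abs_tendsto_at_top) simp
  have cf: "c * f \<ge> 0" "c + f \<ge> 0"
    using c(1) f(1) by auto
  note E_defs = \<open>E1 = _\<close> \<open>E2 = _\<close> \<open>E3 = _\<close> \<open>E4 = _\<close> \<open>E5 = _\<close> \<open>E6 = _\<close>
  note D = \<open>D = _\<close>
  define root where "root z \<longleftrightarrow> A * z\<^sup>2 + B * z + C = 0" for z
  have zero_iff_root: "?r \<sigma> = 0 \<longleftrightarrow> root (\<sigma>\<^sup>2)" if "\<sigma> > 0" for \<sigma>
    unfolding root_def by (rule zero_iff[OF that])
  have optimal_iff: "optimal_minimizer F (t, x) (s, y) \<sigma> \<longleftrightarrow> \<sigma> > 0 \<and> root (\<sigma>\<^sup>2)" for \<sigma>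
    using zero_iff_root by (auto simp: optimal_minimizer_iff)
  have factors: "\<exists>z1 z2.
      z1 = (- B + sgn A * sqrt D) / (2 * A) \<and> z2 = (- B - sgn A * sqrt D) / (2 * A) \<and>
      z1 \<ge> z2 \<and> (z1 = z2 \<longleftrightarrow> D = 0) \<and>
      A * B = - A\<^sup>2 * (z1 + z2) \<and> A * C = A\<^sup>2 * (z1 * z2) \<and> (\<forall>z. root z \<longleftrightarrow> z = z1 \<or> z = z2)"
    if "A \<noteq> 0" "D \<ge> 0"
    using that unfolding D root_def by (rule quadratic_factors) blast
  have no_minimizer: "\<nexists>\<sigma>. minimizer F (t, x) (s, y) \<sigma>"
    if "residual_inf F (t, x) (s, y) = 0" "\<And>\<sigma>. \<sigma> > 0 \<Longrightarrow> ?r \<sigma> \<noteq> 0"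
    using that by (auto simp: minimizer_def)
  have inf_0: "residual_inf F (t, x) (s, y) = 0" if "?r 0 = 0"
    using abs_tendsto_0 that
    by (intro residual_inf_eqI[where G = "at_right 0"]) (auto simp: eventually_at_right_less)
  \<comment> \<open>For \<open>A = 0\<close> the limit at infinity is zero, which fixes the infimum
    whether or not it is attained.\<close>
  have inf_top: "residual_inf F (t, x) (s, y) = 0" if "A = 0"
    using abs_tendsto_at_top that
    by (intro residual_inf_eqI[where G = at_top]) (auto simp: eventually_gt_at_top)

  have cases: "exactly_one [E1, E2, E3, E4, E5, E6]"
  proof (cases "A = 0")
    case True
    then show ?thesis
      by (auto simp: E_defs exactly_one_Cons not_less)
  next
    case False
    \<comment> \<open>For nonzero \<open>A\<close> the only sign pattern that no case lists is
      \<open>D > 0\<close>, \<open>A * B = 0\<close>, \<open>A * C \<ge> 0\<close>. It cannot occur,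
      because \<open>B = 0\<close> gives \<open>D = - 4 * A * C\<close>.\<close>
    have "D \<le> 0" if "A * B = 0" "A * C \<ge> 0"
    proof -
      have "B = 0" using that(1) False by simp
      with that(2) show ?thesis by (simp add: D)
    qed
    moreover have "A * B < 0 \<or> A * B = 0 \<or> A * B > 0" "A * C < 0 \<or> A * C = 0 \<or> A * C > 0"
      by linarith+
    ultimately show ?thesis
      using False by (simp add: E_defs exactly_one_Cons del: mult_eq_0_iff) linarith
  qed

  have 1: "\<forall>\<sigma>>0. optimal_minimizer F (t, x) (s, y) \<sigma>" if E1
    using that by (simp add: E_defs optimal_iff root_def)

  have 2: "\<forall>\<sigma>. optimal_minimizer F (t, x) (s, y) \<sigma> \<longleftrightarrow> \<sigma> = sqrt (- ((b * f + e * c) / (b + e)))"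
    if E2
  proof -
    have A: "A = 0" and BC: "B * C < 0" using that by (auto simp: E_defs)
    \<comment> \<open>With \<open>A = 0\<close> the quadratic degenerates to
      \<open>B * z + C\<close>, and the claimed square of the scale is its only zero,
      \<open>- (C / B)\<close>.\<close>
    have "b + e = - B" "b * f + e * c = - C" using A by (simp_all add: B C)
    then have "- ((b * f + e * c) / (b + e)) = - (C / B)"
      by simp
    moreover have "- (C / B) > 0"
      using BC by (auto simp: mult_less_0_iff divide_less_0_iff)
    moreover have "root z \<longleftrightarrow> z = - (C / B)" for z
    proof -
      have "B \<noteq> 0" using BC by auto
      then show ?thesis using A by (simp add: root_def add_eq_0_iff field_simps)
    qed
    ultimately show ?thesis
      by (metis optimal_iff sqrt_eq_iff_pos)
  qed

  have 3: "(\<nexists>\<sigma>. minimizer F (t, x) (s, y) \<sigma>) \<and> exactly_one [E3a, E3b] \<and>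
      (E3a \<longrightarrow> residual_inf F (t, x) (s, y) = Rinf \<and> Rinf = R0 \<and> R0 = 0) \<and>
      (E3b \<longrightarrow> residual_inf F (t, x) (s, y) = Rinf \<and> Rinf = 0 \<and> 0 < R0)"
    if E3
  proof -
    have A: "A = 0" and BC: "B * C \<ge> 0" "B \<noteq> 0 \<or> C \<noteq> 0" using that by (auto simp: E_defs)
    have "B * z + C \<noteq> 0" if "z > 0" for z
    proof
      assume "B * z + C = 0"
      \<comment> \<open>The first equation makes \<open>B * C\<close> nonpositive; being also
        nonnegative it is zero, so \<open>B = 0\<close>, and the second equation gives
        \<open>C = 0\<close>.\<close>
      then have "B * C = - (B\<^sup>2 * z)" "C = - (B * z)"
        by (auto simp: power2_eq_square algebra_simps) algebra
      with BC that show False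
        by (auto simp: mult_le_0_iff zero_le_mult_iff)
    qed
    then have "\<nexists>\<sigma>. minimizer F (t, x) (s, y) \<sigma>"
      using inf_top[OF A] A by (intro no_minimizer) (auto simp: zero_iff_root root_def)
    moreover have "exactly_one [E3a, E3b]"
      using \<open>E3a = _\<close> \<open>E3b = _\<close> cf by (auto simp: exactly_one_Cons)
    moreover have "?r 0 = 0" if E3a
      using that \<open>E3a = _\<close> at_0_eq_0_iff by blast
    moreover have "?r 0 \<noteq> 0" if E3b
    proof -
      \<comment> \<open>Two of the three ways for \<open>r 0\<close> to vanish would force
        \<open>B = C = 0\<close>: having no pole, and having one pole with \<open>B = 0\<close>. The
        remaining way is \<open>E3a\<close>.\<close>
      have "c + f > 0"
      proof (rule ccontr)
        assume "\<not> c + f > 0"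
        then have "b = 0 \<and> c = 0 \<and> e = 0 \<and> f = 0" using cf no_pole by simp
        then have "B = 0" "C = 0" by (simp_all add: B C)
        with BC show False by simp
      qed
      moreover have "C = 0" if "c * f = 0" "B = 0"
        using that c f A by (auto simp: B C)
      ultimately show ?thesis
        using that BC \<open>E3b = _\<close> at_0_eq_0_iff by auto
    qed
    ultimately show ?thesis
      using inf_top[OF A] A by (auto simp: R0 Rinf)
  qed

  have 4: "sqrt ((- B + sqrt D) / (2 * A)) \<noteq> sqrt ((- B - sqrt D) / (2 * A)) \<and>
      (\<forall>\<sigma>. optimal_minimizer F (t, x) (s, y) \<sigma> \<longleftrightarrow>
         \<sigma> = sqrt ((- B + sqrt D) / (2 * A)) \<or> \<sigma> = sqrt ((- B - sqrt D) / (2 * A)))"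
    if E4
  proof -
    have h: "A \<noteq> 0" "D > 0" "A * B < 0" "A * C > 0" using that by (auto simp: E_defs)
    obtain z1 z2 where
      z: "z1 = (- B + sgn A * sqrt D) / (2 * A)" "z2 = (- B - sgn A * sqrt D) / (2 * A)"
        "z1 \<ge> z2" "z1 = z2 \<longleftrightarrow> D = 0" "A * B = - A\<^sup>2 * (z1 + z2)" "A * C = A\<^sup>2 * (z1 * z2)"
        "\<And>z. root z \<longleftrightarrow> z = z1 \<or> z = z2"
      using factors[OF h(1) less_imp_le[OF h(2)]] by blast
    \<comment> \<open>A positive product gives the roots equal signs, and the positive sum then
      makes both positive.\<close>
    have "z1 + z2 > 0" "z1 * z2 > 0"
      using h z(5,6) by (auto simp: zero_less_mult_iff mult_less_0_iff)
    then have pos: "z1 > 0" "z2 > 0"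
      by (auto simp: zero_less_mult_iff)
    then have sqrt: "optimal_minimizer F (t, x) (s, y) \<sigma> \<longleftrightarrow> \<sigma> = sqrt z1 \<or> \<sigma> = sqrt z2" for \<sigma>
      by (auto simp: optimal_iff z(7) sqrt_eq_iff_pos)
    have ne: "sqrt z1 \<noteq> sqrt z2"
      using z(4) h(2) by simp
    show ?thesis
    \<comment> \<open>The roots are ordered by size, the claimed formulas by the sign of the square
      root; for negative \<open>A\<close> the two labellings are swapped.\<close>
    proof (cases "A > 0")
      case True
      then have "z1 = (- B + sqrt D) / (2 * A)" "z2 = (- B - sqrt D) / (2 * A)"
        using z(1,2) by simp_all
      with sqrt ne show ?thesis by metis
    next
      case False
      then have "z2 = (- B + sqrt D) / (2 * A)" "z1 = (- B - sqrt D) / (2 * A)"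
        using z(1,2) h(1) by simp_all
      with sqrt ne show ?thesis by metis
    qed
  qed

  have 5: "\<forall>\<sigma>. optimal_minimizer F (t, x) (s, y) \<sigma> \<longleftrightarrow> \<sigma> = sqrt ((- B + sgn A * sqrt D) / (2 * A))"
    if E5
  proof -
    have h: "A \<noteq> 0" "D \<ge> 0"
      and alt: "(A * B < 0 \<and> A * C = 0) \<or> A * C < 0 \<or> (D = 0 \<and> A * B < 0)"
      using that by (auto simp: E_defs)
    obtain z1 z2 where
      z: "z1 = (- B + sgn A * sqrt D) / (2 * A)" "z2 = (- B - sgn A * sqrt D) / (2 * A)"
        "z1 \<ge> z2" "z1 = z2 \<longleftrightarrow> D = 0" "A * B = - A\<^sup>2 * (z1 + z2)" "A * C = A\<^sup>2 * (z1 * z2)"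
        "\<And>z. root z \<longleftrightarrow> z = z1 \<or> z = z2"
      using factors[OF h] by blast
    have "A * B < 0 \<longleftrightarrow> z1 + z2 > 0" "A * C < 0 \<longleftrightarrow> z1 * z2 < 0" "A * C = 0 \<longleftrightarrow> z1 * z2 = 0"
      using h(1) z(5,6) by (auto simp: zero_less_mult_iff mult_less_0_iff)
    with alt z(4) have "(z1 + z2 > 0 \<and> z1 * z2 = 0) \<or> z1 * z2 < 0 \<or> (z1 = z2 \<and> z1 + z2 > 0)"
      by simp
    \<comment> \<open>In each alternative the larger root is positive, while the smaller one is
      nonpositive or coincides with it. So exactly one scale survives.\<close>
    then have "z1 > 0" "z2 \<le> 0 \<or> z2 = z1"
      using z(3) by (auto simp: mult_less_0_iff)
    then have "optimal_minimizer F (t, x) (s, y) \<sigma> \<longleftrightarrow> \<sigma> = sqrt z1" for \<sigma>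
      by (auto simp: optimal_iff z(7) sqrt_eq_iff_pos)
    then show ?thesis unfolding z(1) by blast
  qed

  have 6: "(\<forall>\<sigma>>0. ?r \<sigma> \<noteq> 0) \<and>
      (\<nexists>\<sigma>. optimal_minimizer F (t, x) (s, y) \<sigma>) \<and>
      exactly_one [E6a, E6b, E6c] \<and>
      (E6a \<longrightarrow> (\<forall>\<sigma>>0. minimizer F (t, x) (s, y) \<sigma> \<and> \<not> optimal_minimizer F (t, x) (s, y) \<sigma>)) \<and>
      (E6b \<longrightarrow> (\<nexists>\<sigma>. minimizer F (t, x) (s, y) \<sigma>) \<and>
         residual_inf F (t, x) (s, y) = R0 \<and> R0 = 0) \<and>
      (E6c \<longrightarrow> residual_inf F (t, x) (s, y) > 0 \<and> R0 > 0)"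
    if E6
  proof -
    have A: "A \<noteq> 0"
      and alt: "(D > 0 \<and> A * B > 0 \<and> A * C \<ge> 0) \<or> (D = 0 \<and> A * B \<ge> 0) \<or> D < 0"
      using that by (auto simp: E_defs)
    have no_root: "\<not> root z" if "z > 0" for z
    proof (cases "D < 0")
      case True
      then show ?thesis
        using discriminant_negative[OF A, of B C z] by (simp add: D discrim_def root_def)
    next
      case False
      then have "D \<ge> 0" by simp
      obtain z1 z2 where
        z: "z1 = (- B + sgn A * sqrt D) / (2 * A)" "z2 = (- B - sgn A * sqrt D) / (2 * A)"
          "z1 \<ge> z2" "z1 = z2 \<longleftrightarrow> D = 0" "A * B = - A\<^sup>2 * (z1 + z2)" "A * C = A\<^sup>2 * (z1 * z2)"
          "\<And>z. root z \<longleftrightarrow> z = z1 \<or> z = z2"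
        using factors[OF A \<open>D \<ge> 0\<close>] by blast
      have "A * B > 0 \<longleftrightarrow> z1 + z2 < 0" "A * B \<ge> 0 \<longleftrightarrow> z1 + z2 \<le> 0" "A * C \<ge> 0 \<longleftrightarrow> z1 * z2 \<ge> 0"
        using A z(5,6) by (auto simp: zero_less_mult_iff zero_le_mult_iff mult_le_0_iff mult_less_0_iff)
      with alt \<open>D \<ge> 0\<close> z(4)
      have "(z1 + z2 < 0 \<and> z1 * z2 \<ge> 0) \<or> (z1 = z2 \<and> z1 + z2 \<le> 0)" by auto
      \<comment> \<open>A nonnegative product excludes opposite strict signs, so a negative sum
        leaves both roots nonpositive; a double root has the sign of the sum.\<close>
      then have "z1 \<le> 0" "z2 \<le> 0" by (auto simp: zero_le_mult_iff)
      then show ?thesis using z(7) that by auto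
    qed
    then have no_zero: "?r \<sigma> \<noteq> 0" if "\<sigma> > 0" for \<sigma>
      using that by (simp add: zero_iff_root)
    \<comment> \<open>Under \<open>E6a\<close>, \<open>C = A * c * f\<close> is nonzero when
      \<open>c * f > 0\<close>, and \<open>B = A * (c + f)\<close> is nonzero when
      \<open>c + f > 0\<close>.\<close>
    have "\<not> E6b" if E6a
    proof
      assume E6b
      then consider "c * f > 0" "C = 0" | "c + f > 0" "B = 0"
        using \<open>E6b = _\<close> by auto
      then show False
        using \<open>E6a\<close> \<open>E6a = _\<close> A by cases auto
    qed
    then have one: "exactly_one [E6a, E6b, E6c]"
      using \<open>E6c = _\<close> by (auto simp: exactly_one_Cons)
    have a: "minimizer F (t, x) (s, y) \<sigma>" if E6a "\<sigma> > 0" for \<sigma>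
      using that \<open>E6a = _\<close> const_if by (intro minimizer_if_const[where k = "\<bar>A\<bar>"]) auto
    have b: "?r 0 = 0" if E6b
      using that \<open>E6b = _\<close> at_0_eq_0_iff by blast
    \<comment> \<open>The third alternative of \<open>at_0_eq_0_iff\<close> requires
      \<open>A = 0\<close>, so here \<open>r 0\<close> vanishes only under
      \<open>E6b\<close>.\<close>
    have c0: "?r 0 \<noteq> 0" if E6c
      using that \<open>E6c = _\<close> \<open>E6b = _\<close> at_0_eq_0_iff A by blast
    have "residual_inf F (t, x) (s, y) > 0" if E6c
      unfolding residual_inf_def using no_zero A c0[OF that] by (rule abs_bounded_away_from_0)
    with no_zero one a b c0 show ?thesis
      using inf_0 no_minimizer by (auto simp: R0 optimal_minimizer_iff)
  qed

  show ?thesis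
    using abs_tendsto_0 abs_tendsto_at_top cases 1 2 3 4 5 6
    unfolding R0 Rinf by blast
qed

end
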